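(* Let $G$ be a group and let $X$ be an infinite transitive $G$-space. A subset $A$ of $X$ is scattered if and only if, for every infinite subset $Y$ of $A$, there exists $p\in Y^*$ such that $\bigtriangleup_p(Y)$ is finite.
   Context: $[G]^{<\omega}$ is the family of all finite subsets of $G$. For $F\in[G]^{<\omega}$ and $x\in X$, $B(x,F)=Fx\cup\{x\}$, where $Fx=\{gx:g\in F\}$; for $Y\subseteq X$ and $y\in Y$, $B_Y(y,F)=B(y,F)\cap Y$. A subset $A$ of $X$ is scattered if, for every infinite subset $Y$ of $A$, there exists $H\in[G]^{<\omega}$ such that, for every $F\in[G]^{<\omega}$, there is $y\in Y$ such that $B_Y(y,F)\setminus B_Y(y,H)=\varnothing$. $\beta X$ is the space of ultrafilters on the discrete space $X$, with points of $X$ identified with principal ultrafilters; $X^*=\beta X\setminus X$, and $Y^*=\{p\in X^*: Y\in p\}$ for $Y\subseteq X$. For $g\in G$ and $p\in\beta X$, $gp=\{gP:P\in p\}$. For $Y\subseteq X$ and $p\in X^*$, $\bigtriangleup_p(Y)=\{gp: g\in G, Y\in gp\}$. *)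

theory Defs
  imports "HOL-Algebra.Group_Action"
begin

text \<open>
  A \<open>G\<close>-space is a set \<open>X\<close> with a \<^locale>\<open>group_action\<close> \<open>\<phi>\<close> of \<open>G\<close> on it, so \<open>gx\<close> is \<open>\<phi> g x\<close>.
  The family of all finite subsets of \<open>G\<close> is \<open>Fpow (carrier G)\<close>.
\<close>

definition Ball_of :: "('g \<Rightarrow> 'x \<Rightarrow> 'x) \<Rightarrow> 'x \<Rightarrow> 'g set \<Rightarrow> 'x set" where
  "Ball_of \<phi> x F = (\<lambda>g. \<phi> g x) ` F \<union> {x}"

definition Ball_in :: "('g \<Rightarrow> 'x \<Rightarrow> 'x) \<Rightarrow> 'x set \<Rightarrow> 'x \<Rightarrow> 'g set \<Rightarrow> 'x set" where
  "Ball_in \<phi> Y y F = Ball_of \<phi> y F \<inter> Y"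

definition scattered ::
  "('g, 'm) monoid_scheme \<Rightarrow> ('g \<Rightarrow> 'x \<Rightarrow> 'x) \<Rightarrow> 'x set \<Rightarrow> bool" where
  "scattered G \<phi> A \<longleftrightarrow>
     (\<forall>Y. Y \<subseteq> A \<and> infinite Y \<longrightarrow>
        (\<exists>H \<in> Fpow (carrier G). \<forall>F \<in> Fpow (carrier G).
           \<exists>y \<in> Y. Ball_in \<phi> Y y F - Ball_in \<phi> Y y H = {}))"

text \<open>
  Ultrafilters are taken on the carrier set \<open>X\<close>, as families of subsets of \<open>X\<close>, rather than on
  the whole type \<open>'x\<close>.
\<close>

definition ultrafilter_on :: "'x set \<Rightarrow> 'x set set \<Rightarrow> bool" where
  "ultrafilter_on X p \<longleftrightarrow>
     p \<subseteq> Pow X \<and> X \<in> p \<and> {} \<notin> p \<and>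
     (\<forall>P \<in> p. \<forall>Q \<in> p. P \<inter> Q \<in> p) \<and>
     (\<forall>P \<in> p. \<forall>Q. P \<subseteq> Q \<and> Q \<subseteq> X \<longrightarrow> Q \<in> p) \<and>
     (\<forall>P. P \<subseteq> X \<longrightarrow> P \<in> p \<or> X - P \<in> p)"

definition Beta :: "'x set \<Rightarrow> 'x set set set" where
  "Beta X = {p. ultrafilter_on X p}"

definition principal_ultrafilter :: "'x set \<Rightarrow> 'x \<Rightarrow> 'x set set" where
  "principal_ultrafilter X x = {P. P \<subseteq> X \<and> x \<in> P}"

text \<open>\<open>X\<^sup>* = \<beta>X - X\<close>, where \<open>X\<close> is identified with the set of principal ultrafilters.\<close>

definition Remainder :: "'x set \<Rightarrow> 'x set set set" where
  "Remainder X = Beta X - principal_ultrafilter X ` X"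

text \<open>The set \<open>Y\<^sup>*\<close> for a subset \<open>Y\<close> of \<open>X\<close>; its elements are ultrafilters on \<open>X\<close>, not on \<open>Y\<close>.\<close>

definition Remainder_of :: "'x set \<Rightarrow> 'x set \<Rightarrow> 'x set set set" where
  "Remainder_of X Y = {p \<in> Remainder X. Y \<in> p}"

definition translate :: "('g \<Rightarrow> 'x \<Rightarrow> 'x) \<Rightarrow> 'g \<Rightarrow> 'x set set \<Rightarrow> 'x set set" where
  "translate \<phi> g p = {\<phi> g ` P | P. P \<in> p}"

definition Triangle ::
  "('g, 'm) monoid_scheme \<Rightarrow> ('g \<Rightarrow> 'x \<Rightarrow> 'x) \<Rightarrow> 'x set set \<Rightarrow> 'x set \<Rightarrow> 'x set set set" where
  "Triangle G \<phi> p Y = {translate \<phi> g p | g. g \<in> carrier G \<and> Y \<in> translate \<phi> g p}"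

end

theory Submission
  imports Defs
begin

text \<open>
  Two translates \<open>gp\<close> and \<open>hp\<close> of an ultrafilter \<open>p\<close> coincide exactly when the permutations \<open>g\<close>
  and \<open>h\<close> agree on a member of \<open>p\<close> (\<open>translate_eq_iff\<close>).  This turns the finiteness of
  \<open>\<triangle>\<^sub>p(Y)\<close> into a statement about points: outside a set that is
  not in \<open>p\<close>, each \<open>g\<close> either moves all points out of \<open>Y\<close> or moves them as one of finitely many
  group elements does.  These elements form the set \<open>H\<close> in the definition of a scattered set.

  If \<open>\<triangle>\<^sub>p(Y) = {h\<^sub>1p, \<dots>, h\<^sub>np}\<close>, put \<open>H = {h\<^sub>1, \<dots>, h\<^sub>n}\<close>.  For a finite \<open>F\<close>, the finitely many
  conditions imposed by the elements of \<open>F\<close> each hold on a member of \<open>p\<close>, hence jointly at some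
  \<open>y \<in> Y\<close>, and this \<open>y\<close> satisfies \<open>B\<^sub>Y(y,F) \<subseteq> B\<^sub>Y(y,H)\<close>.

  Conversely, given \<open>H\<close>, let \<open>Y\<^sub>F\<close> be the set of \<open>y \<in> Y\<close> with \<open>B\<^sub>Y(y,F) \<subseteq> B\<^sub>Y(y,H)\<close>.  These sets
  are nonempty and \<open>Y\<^bsub>F \<union> F'\<^esub> \<subseteq> Y\<^sub>F \<inter> Y\<^bsub>F'\<^esub>\<close>, so some ultrafilter \<open>p\<close> contains them all.  A point
  \<open>y\<close> common to all \<open>Y\<^sub>F\<close> would, by transitivity, force \<open>Y\<close> into the finite set \<open>B(y,H)\<close>; hence \<open>p\<close>
  is free.  If \<open>Y \<in> gp\<close>, then on a member of \<open>p\<close> the element \<open>g\<close> acts as some element of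
  \<open>H \<union> {1}\<close>, so \<open>gp\<close> is one of finitely many ultrafilters.
\<close>

section \<open>Ultrafilters on a set\<close>

lemma ultrafilter_on_subset:
  "ultrafilter_on X p \<Longrightarrow> P \<in> p \<Longrightarrow> P \<subseteq> X"
  unfolding ultrafilter_on_def by blast

lemma ultrafilter_on_nonempty:
  "ultrafilter_on X p \<Longrightarrow> P \<in> p \<Longrightarrow> P \<noteq> {}"
  unfolding ultrafilter_on_def by blast

lemma ultrafilter_on_top:
  "ultrafilter_on X p \<Longrightarrow> X \<in> p"
  unfolding ultrafilter_on_def by blast

lemma ultrafilter_on_Int:
  "ultrafilter_on X p \<Longrightarrow> P \<in> p \<Longrightarrow> Q \<in> p \<Longrightarrow> P \<inter> Q \<in> p"
  unfolding ultrafilter_on_def by blast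

lemma ultrafilter_on_mono:
  "ultrafilter_on X p \<Longrightarrow> P \<in> p \<Longrightarrow> P \<subseteq> Q \<Longrightarrow> Q \<subseteq> X \<Longrightarrow> Q \<in> p"
  unfolding ultrafilter_on_def by blast

lemma ultrafilter_on_Diff:
  "ultrafilter_on X p \<Longrightarrow> P \<subseteq> X \<Longrightarrow> P \<notin> p \<Longrightarrow> X - P \<in> p"
  unfolding ultrafilter_on_def by blast

lemma ultrafilter_on_INT:
  assumes "ultrafilter_on X p" "finite I" "\<And>i. i \<in> I \<Longrightarrow> P i \<in> p"
  shows "X \<inter> (\<Inter>i\<in>I. P i) \<in> p"
  using assms(2,3)
proof (induction I rule: finite_induct)
  case empty
  then show ?case using ultrafilter_on_top[OF assms(1)] by simp
next
  case (insert i I)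
  then have "P i \<inter> (X \<inter> (\<Inter>i\<in>I. P i)) \<in> p"
    using ultrafilter_on_Int[OF assms(1)] by simp
  then show ?case by (simp add: Int_left_commute)
qed

lemma ultrafilter_on_UN:
  assumes p: "ultrafilter_on X p" and "finite I" "(\<Union>i\<in>I. P i) \<in> p"
  shows "\<exists>i\<in>I. P i \<in> p"
proof (rule ccontr)
  assume neg: "\<not> (\<exists>i\<in>I. P i \<in> p)"
  have "P i \<subseteq> X" if "i \<in> I" for i
    using ultrafilter_on_subset[OF p assms(3)] that by blast
  then have "X \<inter> (\<Inter>i\<in>I. X - P i) \<in> p"
    using neg by (intro ultrafilter_on_INT[OF p \<open>finite I\<close>] ultrafilter_on_Diff[OF p]) auto
  from ultrafilter_on_nonempty[OF p ultrafilter_on_Int[OF p this assms(3)]] show False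
    by blast
qed

lemma free_ultrafilterI:
  assumes "ultrafilter_on X p" and "\<And>x. x \<in> X \<Longrightarrow> \<exists>P\<in>p. x \<notin> P"
  shows "p \<in> Remainder X"
  using assms unfolding Remainder_def Beta_def principal_ultrafilter_def by blast

text \<open>
  By Zorn's lemma there is a maximal family with the finite intersection property above \<open>S\<close>.
  Such a family contains every subset \<open>P\<close> of \<open>X\<close> that is compatible with all its finite
  intersections, and one of \<open>P\<close>, \<open>X - P\<close> always is.
\<close>

lemma ultrafilter_on_extends:
  assumes S: "S \<subseteq> Pow X" and fip: "\<And>T. finite T \<Longrightarrow> T \<subseteq> S \<Longrightarrow> X \<inter> \<Inter>T \<noteq> {}"
  shows "\<exists>p. ultrafilter_on X p \<and> S \<subseteq> p"
proof -
  define FIP where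
    "FIP = {C. S \<subseteq> C \<and> C \<subseteq> Pow X \<and> (\<forall>T. finite T \<and> T \<subseteq> C \<longrightarrow> X \<inter> \<Inter>T \<noteq> {})}"
  have bound: "\<exists>U\<in>FIP. \<forall>C\<in>K. C \<subseteq> U" if K: "subset.chain FIP K" for K
  proof (cases "K = {}")
    case True
    have "S \<in> FIP" using assms unfolding FIP_def by simp
    with True show ?thesis by blast
  next
    case False
    have KF: "K \<subseteq> FIP" using K unfolding subset.chain_def by blast
    have "X \<inter> \<Inter>T \<noteq> {}" if T: "finite T" "T \<subseteq> \<Union>K" for T
    proof -
      from finite_subset_Union_chain[OF T False K]
      obtain C where C: "C \<in> K" "T \<subseteq> C" .
      with KF T(1) show ?thesis unfolding FIP_def by blast
    qed
    moreover have "S \<subseteq> \<Union>K" "\<Union>K \<subseteq> Pow X"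
      using KF False unfolding FIP_def by blast+
    ultimately have "\<Union>K \<in> FIP" unfolding FIP_def by blast
    then show ?thesis by blast
  qed
  obtain p where "p \<in> FIP" and p_max: "\<And>C. C \<in> FIP \<Longrightarrow> p \<subseteq> C \<Longrightarrow> C = p"
    using subset_Zorn[OF bound] by blast
  then have Sp: "S \<subseteq> p" and pX: "p \<subseteq> Pow X"
    and p_fip: "\<And>T. finite T \<Longrightarrow> T \<subseteq> p \<Longrightarrow> X \<inter> \<Inter>T \<noteq> {}"
    unfolding FIP_def by auto
  have in_p: "P \<in> p"
    if P: "P \<subseteq> X" and meets: "\<And>T. finite T \<Longrightarrow> T \<subseteq> p \<Longrightarrow> X \<inter> P \<inter> \<Inter>T \<noteq> {}" for P
  proof -
    have "X \<inter> \<Inter>T \<noteq> {}" if T: "finite T" "T \<subseteq> insert P p" for T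
    proof -
      have "X \<inter> P \<inter> \<Inter>(T - {P}) \<noteq> {}" using T by (intro meets) auto
      moreover have "X \<inter> P \<inter> \<Inter>(T - {P}) \<subseteq> X \<inter> \<Inter>T" by blast
      ultimately show ?thesis by blast
    qed
    then have "insert P p \<in> FIP" using Sp pX P unfolding FIP_def by auto
    from p_max[OF this] show ?thesis by blast
  qed
  have top: "X \<in> p"
    using p_fip by (intro in_p) auto
  have int: "P \<inter> Q \<in> p" if PQ: "P \<in> p" "Q \<in> p" for P Q
  proof (rule in_p)
    show "P \<inter> Q \<subseteq> X" using PQ pX by blast
    fix T assume "finite T" "T \<subseteq> p"
    then have "X \<inter> \<Inter>(insert P (insert Q T)) \<noteq> {}" using PQ by (intro p_fip) auto
    then show "X \<inter> (P \<inter> Q) \<inter> \<Inter>T \<noteq> {}" by auto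
  qed
  have up: "Q \<in> p" if PQ: "P \<in> p" "P \<subseteq> Q" "Q \<subseteq> X" for P Q
  proof (rule in_p)
    show "Q \<subseteq> X" by fact
    fix T assume "finite T" "T \<subseteq> p"
    then have "X \<inter> \<Inter>(insert P T) \<noteq> {}" using PQ by (intro p_fip) auto
    then show "X \<inter> Q \<inter> \<Inter>T \<noteq> {}" using PQ(2) by auto
  qed
  have ultra: "P \<in> p \<or> X - P \<in> p" if P: "P \<subseteq> X" for P
  proof (rule disjCI)
    assume notin: "X - P \<notin> p"
    show "P \<in> p"
    proof (rule in_p[OF P])
      fix T assume T: "finite T" "T \<subseteq> p"
      obtain T' where T': "finite T'" "T' \<subseteq> p" "X \<inter> (X - P) \<inter> \<Inter>T' = {}"
        using in_p[of "X - P"] notin by blast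
      have "X \<inter> \<Inter>(T \<union> T') \<noteq> {}" using T T' by (intro p_fip) auto
      then show "X \<inter> P \<inter> \<Inter>T \<noteq> {}" using T'(3) by blast
    qed
  qed
  have "{} \<notin> p" using p_fip[of "{{}}"] by auto
  then have "ultrafilter_on X p"
    unfolding ultrafilter_on_def using pX top int up ultra by blast
  with Sp show ?thesis by blast
qed

text \<open>
  Take \<open>B\<close> maximal among the sets of non-fixed points that are disjoint from their image.  By
  maximality every non-fixed point lies in \<open>B\<close>, in its image or in its preimage.  Invariance
  makes membership in \<open>p\<close> equivalent for these three sets, and since \<open>B\<close> misses its preimage
  none of them belongs to \<open>p\<close>; so the fixed points do.
\<close>

lemma invariant_ultrafilter_fixed_points:
  assumes p: "ultrafilter_on X p" and inj: "inj_on f X" and maps: "f ` X \<subseteq> X"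
    and inv: "\<And>Q. Q \<subseteq> X \<Longrightarrow> {x \<in> X. f x \<in> Q} \<in> p \<longleftrightarrow> Q \<in> p"
  shows "{x \<in> X. f x = x} \<in> p"
proof (rule ccontr)
  assume neg: "{x \<in> X. f x = x} \<notin> p"
  define D where "D = {x \<in> X. f x \<noteq> x}"
  have "X - {x \<in> X. f x = x} \<in> p" using neg by (intro ultrafilter_on_Diff[OF p]) auto
  moreover have "X - {x \<in> X. f x = x} = D" unfolding D_def by blast
  ultimately have D: "D \<in> p" by simp
  define M where "M = {B. B \<subseteq> D \<and> f ` B \<inter> B = {}}"
  have bound: "\<exists>U\<in>M. \<forall>B\<in>K. B \<subseteq> U" if K: "subset.chain M K" for K
  proof -
    have KM: "K \<subseteq> M" and lin: "\<And>B C. B \<in> K \<Longrightarrow> C \<in> K \<Longrightarrow> B \<subseteq> C \<or> C \<subseteq> B"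
      using K unfolding subset_chain_def by blast+
    have "f x \<notin> C" if "x \<in> B" "B \<in> K" "C \<in> K" for x B C
      using lin[OF that(2,3)] KM that unfolding M_def by blast
    then have "f ` \<Union>K \<inter> \<Union>K = {}" by blast
    moreover have "\<Union>K \<subseteq> D" using KM unfolding M_def by blast
    ultimately have "\<Union>K \<in> M" unfolding M_def by blast
    then show ?thesis by blast
  qed
  obtain B where "B \<in> M" and B_max: "\<And>C. C \<in> M \<Longrightarrow> B \<subseteq> C \<Longrightarrow> C = B"
    using subset_Zorn[OF bound] by blast
  then have BD: "B \<subseteq> D" and disj: "f ` B \<inter> B = {}" unfolding M_def by auto
  have BX: "B \<subseteq> X" using BD unfolding D_def by blast
  have cover: "x \<in> B \<union> {x \<in> X. f x \<in> B} \<union> f ` B" if x: "x \<in> D" for x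
  proof (rule ccontr)
    assume "x \<notin> B \<union> {x \<in> X. f x \<in> B} \<union> f ` B"
    with x have n: "x \<notin> B" "f x \<notin> B" "x \<notin> f ` B" "f x \<noteq> x" unfolding D_def by auto
    have "insert x B \<in> M" unfolding M_def using n x BD disj by auto
    from B_max[OF this] n(1) show False by blast
  qed
  have "{x \<in> X. f x \<in> B} \<inter> B = {}" using disj by blast
  then have B_notin: "B \<notin> p"
    using inv[OF BX] ultrafilter_on_Int[OF p] ultrafilter_on_nonempty[OF p] by metis
  have pre_notin: "{x \<in> X. f x \<in> B} \<notin> p" using inv[OF BX] B_notin by simp
  have "f ` B \<subseteq> X" using BX maps by blast
  moreover have "{x \<in> X. f x \<in> f ` B} = B"
    using BX inj by (auto dest: inj_onD)
  ultimately have im_notin: "f ` B \<notin> p" using inv[of "f ` B"] B_notin by simp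
  have "X - B \<in> p" "X - {x \<in> X. f x \<in> B} \<in> p" "X - f ` B \<in> p"
    using B_notin pre_notin im_notin BX \<open>f ` B \<subseteq> X\<close>
    by (auto intro!: ultrafilter_on_Diff[OF p])
  then have "D \<inter> ((X - B) \<inter> ((X - {x \<in> X. f x \<in> B}) \<inter> (X - f ` B))) \<in> p"
    using D by (intro ultrafilter_on_Int[OF p])
  from ultrafilter_on_nonempty[OF p this] cover show False by blast
qed

section \<open>Translates of an ultrafilter under a group action\<close>

context group_action
begin

lemma mem_translate_iff:
  assumes p: "ultrafilter_on E p" and g: "g \<in> carrier G"
  shows "Q \<in> translate \<phi> g p \<longleftrightarrow> Q \<subseteq> E \<and> {x \<in> E. \<phi> g x \<in> Q} \<in> p"
proof
  assume "Q \<in> translate \<phi> g p"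
  then obtain P where P: "P \<in> p" "Q = \<phi> g ` P" unfolding translate_def by blast
  have PE: "P \<subseteq> E" using ultrafilter_on_subset[OF p P(1)] .
  have "{x \<in> E. \<phi> g x \<in> Q} = P"
    using PE P(2) inj_prop[OF g] by (auto dest: inj_onD)
  moreover have "Q \<subseteq> E" using PE P(2) surj_prop[OF g] by blast
  ultimately show "Q \<subseteq> E \<and> {x \<in> E. \<phi> g x \<in> Q} \<in> p" using P(1) by simp
next
  assume Q: "Q \<subseteq> E \<and> {x \<in> E. \<phi> g x \<in> Q} \<in> p"
  have "Q \<subseteq> \<phi> g ` E" using Q surj_prop[OF g] by simp
  then have "Q = \<phi> g ` {x \<in> E. \<phi> g x \<in> Q}" by auto
  with Q show "Q \<in> translate \<phi> g p" unfolding translate_def by auto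
qed

text \<open>
  If \<open>gp = hp\<close>, then \<open>p\<close> is invariant under \<open>h\<inverse>g\<close>, whose fixed points are the points at which
  \<open>g\<close> and \<open>h\<close> agree.
\<close>

lemma translate_eq_iff:
  assumes p: "ultrafilter_on E p" and g: "g \<in> carrier G" and h: "h \<in> carrier G"
  shows "translate \<phi> g p = translate \<phi> h p \<longleftrightarrow> {x \<in> E. \<phi> g x = \<phi> h x} \<in> p"
proof
  assume agree: "{x \<in> E. \<phi> g x = \<phi> h x} \<in> p"
  have half: "{x \<in> E. \<phi> b x \<in> Q} \<in> p"
    if "{x \<in> E. \<phi> a x = \<phi> b x} \<in> p" "{x \<in> E. \<phi> a x \<in> Q} \<in> p" for a b Q
    by (rule ultrafilter_on_mono[OF p ultrafilter_on_Int[OF p that]]) auto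
  have agree': "{x \<in> E. \<phi> h x = \<phi> g x} \<in> p" using agree by (simp add: eq_commute)
  show "translate \<phi> g p = translate \<phi> h p"
    by (rule Set.set_eqI, unfold mem_translate_iff[OF p g] mem_translate_iff[OF p h])
      (use half[OF agree] half[OF agree'] in auto)
next
  assume eq: "translate \<phi> g p = translate \<phi> h p"
  interpret group G using group_hom unfolding group_hom_def by blast
  define k where "k = inv h \<otimes> g"
  have ih: "inv h \<in> carrier G" and k: "k \<in> carrier G" using g h unfolding k_def by auto
  have act: "\<phi> k x = \<phi> (inv h) (\<phi> g x)" if "x \<in> E" for x
    using composition_rule[OF that ih g] unfolding k_def .
  have gE: "\<phi> a x \<in> E" if "x \<in> E" "a \<in> carrier G" for x a
    using element_image[OF that(2,1) refl] .
  have cancel: "\<phi> (inv h) (\<phi> h x) = x" if "x \<in> E" for x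
    using orbit_sym_aux[OF h that refl] .
  have inj_ih: "\<phi> (inv h) u = \<phi> (inv h) v \<longleftrightarrow> u = v" if "u \<in> E" "v \<in> E" for u v
    using inj_prop[OF ih] that by (auto dest: inj_onD)
  have "{x \<in> E. \<phi> k x \<in> Q} \<in> p \<longleftrightarrow> Q \<in> p" if Q: "Q \<subseteq> E" for Q
  proof -
    define R where "R = {z \<in> E. \<phi> (inv h) z \<in> Q}"
    have "{x \<in> E. \<phi> k x \<in> Q} = {x \<in> E. \<phi> g x \<in> R}"
      unfolding R_def using act gE g by auto
    moreover have "{x \<in> E. \<phi> h x \<in> R} = Q"
      unfolding R_def using cancel gE h Q by auto
    moreover have "R \<subseteq> E" unfolding R_def by blast
    ultimately show ?thesis
      using eq mem_translate_iff[OF p g, of R] mem_translate_iff[OF p h, of R] by simp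
  qed
  then have "{x \<in> E. \<phi> k x = x} \<in> p"
    using inj_prop[OF k] surj_prop[OF k]
    by (intro invariant_ultrafilter_fixed_points[OF p]) auto
  moreover have "\<phi> k x = x \<longleftrightarrow> \<phi> g x = \<phi> h x" if "x \<in> E" for x
    using act[OF that] cancel[OF that] inj_ih[OF gE[OF that g] gE[OF that h]] by simp
  then have "{x \<in> E. \<phi> k x = x} = {x \<in> E. \<phi> g x = \<phi> h x}" by blast
  ultimately show "{x \<in> E. \<phi> g x = \<phi> h x} \<in> p" by simp
qed

section \<open>Finite sets of translates and balls\<close>

text \<open>
  Representatives of the finitely many translates serve as \<open>H\<close>: on a member of \<open>p\<close> each \<open>g\<close> either
  leaves \<open>Y\<close> or agrees with a representative.
\<close>

lemma finite_Triangle_imp_bounded_balls: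
  assumes p: "ultrafilter_on E p" and Y: "Y \<in> p" and fin: "finite (Triangle G \<phi> p Y)"
  shows "\<exists>H \<in> Fpow (carrier G). \<forall>F \<in> Fpow (carrier G).
    \<exists>y \<in> Y. Ball_in \<phi> Y y F - Ball_in \<phi> Y y H = {}"
proof -
  have YE: "Y \<subseteq> E" using ultrafilter_on_subset[OF p Y] .
  have "Triangle G \<phi> p Y \<subseteq> (\<lambda>g. translate \<phi> g p) ` carrier G"
    unfolding Triangle_def by blast
  from finite_subset_image[OF fin this] obtain H where
    H: "H \<subseteq> carrier G" "finite H" and T: "Triangle G \<phi> p Y = (\<lambda>g. translate \<phi> g p) ` H"
    by blast
  define good where "good g = {x \<in> E. \<phi> g x \<in> Y \<longrightarrow> \<phi> g x \<in> (\<lambda>h. \<phi> h x) ` H}" for g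
  have good: "good g \<in> p" if g: "g \<in> carrier G" for g
  proof (cases "Y \<in> translate \<phi> g p")
    case True
    then have "translate \<phi> g p \<in> Triangle G \<phi> p Y" using g unfolding Triangle_def by blast
    then obtain h where h: "h \<in> H" "translate \<phi> g p = translate \<phi> h p" unfolding T by blast
    then have "{x \<in> E. \<phi> g x = \<phi> h x} \<in> p"
      using translate_eq_iff[OF p g] H(1) by blast
    then show ?thesis
      by (rule ultrafilter_on_mono[OF p]) (use h(1) in \<open>auto simp: good_def\<close>)
  next
    case False
    then have "E - {x \<in> E. \<phi> g x \<in> Y} \<in> p"
      using mem_translate_iff[OF p g] YE by (intro ultrafilter_on_Diff[OF p]) auto
    then show ?thesis
      by (rule ultrafilter_on_mono[OF p]) (auto simp: good_def)
  qed
  have "\<exists>y \<in> Y. Ball_in \<phi> Y y F - Ball_in \<phi> Y y H = {}" if F: "F \<in> Fpow (carrier G)" for F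
  proof -
    have "E \<inter> (\<Inter>g\<in>F. good g) \<in> p"
      using F good by (intro ultrafilter_on_INT[OF p]) (auto simp: Fpow_def)
    from ultrafilter_on_nonempty[OF p ultrafilter_on_Int[OF p Y this]]
    obtain y where y: "y \<in> Y" "\<And>g. g \<in> F \<Longrightarrow> y \<in> good g" by blast
    then have "Ball_in \<phi> Y y F \<subseteq> Ball_in \<phi> Y y H"
      unfolding Ball_in_def Ball_of_def good_def by blast
    with y(1) show ?thesis by blast
  qed
  then show ?thesis using H unfolding Fpow_def by blast
qed

end

text \<open>
  The points whose \<open>F\<close>-ball in \<open>Y\<close> is bounded by \<open>H\<close> shrink as \<open>F\<close> grows, so an ultrafilter
  contains all of these sets.  Transitivity makes it free: a point that belongs to every one of them
  sees the whole infinite set \<open>Y\<close> inside a finite ball.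
\<close>

lemma (in transitive_action) bounded_balls_imp_finite_Triangle:
  assumes Y: "Y \<subseteq> E" "infinite Y" and H: "H \<in> Fpow (carrier G)"
    and balls: "\<And>F. F \<in> Fpow (carrier G) \<Longrightarrow>
      \<exists>y \<in> Y. Ball_in \<phi> Y y F - Ball_in \<phi> Y y H = {}"
  shows "\<exists>p \<in> Remainder_of E Y. finite (Triangle G \<phi> p Y)"
proof -
  interpret group G using group_hom unfolding group_hom_def by blast
  define bdd where "bdd F = {y \<in> Y. Ball_in \<phi> Y y F - Ball_in \<phi> Y y H = {}}" for F
  have bdd_antimono: "bdd F' \<subseteq> bdd F" if "F \<subseteq> F'" for F F'
    using that unfolding bdd_def Ball_in_def Ball_of_def by blast
  have "\<exists>p. ultrafilter_on E p \<and> bdd ` Fpow (carrier G) \<subseteq> p"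
  proof (rule ultrafilter_on_extends)
    show "bdd ` Fpow (carrier G) \<subseteq> Pow E" using Y(1) unfolding bdd_def by auto
    fix T assume "finite T" "T \<subseteq> bdd ` Fpow (carrier G)"
    from finite_subset_image[OF this] obtain \<F> where
      \<F>: "\<F> \<subseteq> Fpow (carrier G)" "finite \<F>" "T = bdd ` \<F>" by blast
    have "\<Union>\<F> \<in> Fpow (carrier G)" using \<F>(1,2) unfolding Fpow_def by auto
    from balls[OF this] obtain y where "y \<in> bdd (\<Union>\<F>)" unfolding bdd_def by blast
    moreover from this have "y \<in> E" using Y(1) unfolding bdd_def by blast
    moreover have "bdd (\<Union>\<F>) \<subseteq> \<Inter>T"
      unfolding \<F>(3) using bdd_antimono[OF Union_upper] by blast
    ultimately show "E \<inter> \<Inter>T \<noteq> {}" by blast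
  qed
  then obtain p where p: "ultrafilter_on E p"
    and bdd_in: "\<And>F. F \<in> Fpow (carrier G) \<Longrightarrow> bdd F \<in> p" by blast
  have Yp: "Y \<in> p"
    by (rule ultrafilter_on_mono[OF p bdd_in[of "{}"] _ Y(1)]) (auto simp: bdd_def Fpow_def)
  have "p \<in> Remainder E"
  proof (rule free_ultrafilterI[OF p], rule ccontr)
    fix x assume x: "x \<in> E" and neg: "\<not> (\<exists>P\<in>p. x \<notin> P)"
    have "Y \<subseteq> Ball_of \<phi> x H"
    proof
      fix z assume z: "z \<in> Y"
      then obtain g where g: "g \<in> carrier G" "\<phi> g x = z"
        using unique_orbit[OF x] Y(1) by blast
      then have "x \<in> bdd {g}" using neg bdd_in[of "{g}"] by (auto simp: Fpow_def)
      then show "z \<in> Ball_of \<phi> x H"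
        using g z unfolding bdd_def Ball_in_def Ball_of_def by auto
    qed
    moreover have "finite (Ball_of \<phi> x H)"
      using H unfolding Ball_of_def Fpow_def by auto
    ultimately show False using Y(2) finite_subset by blast
  qed
  with Yp have pY: "p \<in> Remainder_of E Y" unfolding Remainder_of_def by blast
  \<comment> \<open>The unit stands for the centre, which a ball contains whatever \<open>H\<close> is.\<close>
  have "Triangle G \<phi> p Y \<subseteq> (\<lambda>h. translate \<phi> h p) ` insert \<one> H"
  proof
    fix q assume "q \<in> Triangle G \<phi> p Y"
    then obtain g where q: "q = translate \<phi> g p" and g: "g \<in> carrier G"
      and Yg: "Y \<in> translate \<phi> g p" unfolding Triangle_def by blast
    have "{x \<in> E. \<phi> g x \<in> Y} \<in> p" using mem_translate_iff[OF p g] Yg by blast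
    moreover have "bdd {g} \<in> p" using g by (intro bdd_in) (auto simp: Fpow_def)
    ultimately have "{x \<in> E. \<phi> g x \<in> Y} \<inter> bdd {g} \<in> p" by (rule ultrafilter_on_Int[OF p])
    moreover have "\<phi> \<one> x = x" if "x \<in> E" for x
      using that id_eq_one restrict_apply'[of x E "\<lambda>x. x"] by simp
    then have "{x \<in> E. \<phi> g x \<in> Y} \<inter> bdd {g} \<subseteq> (\<Union>h\<in>insert \<one> H. {x \<in> E. \<phi> g x = \<phi> h x})"
      unfolding bdd_def Ball_in_def Ball_of_def by auto
    ultimately have "(\<Union>h\<in>insert \<one> H. {x \<in> E. \<phi> g x = \<phi> h x}) \<in> p"
      by (rule ultrafilter_on_mono[OF p]) auto
    then obtain h where h: "h \<in> insert \<one> H" "{x \<in> E. \<phi> g x = \<phi> h x} \<in> p"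
      using ultrafilter_on_UN[OF p] H unfolding Fpow_def by blast
    then have "h \<in> carrier G" using H unfolding Fpow_def by auto
    then have "q = translate \<phi> h p" using translate_eq_iff[OF p g] h(2) q by blast
    with h(1) show "q \<in> (\<lambda>h. translate \<phi> h p) ` insert \<one> H" by blast
  qed
  moreover have "finite ((\<lambda>h. translate \<phi> h p) ` insert \<one> H)"
    using H unfolding Fpow_def by auto
  ultimately show ?thesis using pY finite_subset by blast
qed

theorem proposition5p2:
  fixes G :: "('g, 'm) monoid_scheme" and X :: "'x set" and \<phi> :: "'g \<Rightarrow> 'x \<Rightarrow> 'x"
    and A :: "'x set"
  assumes "transitive_action G X \<phi>"
    and "infinite X"
    and "A \<subseteq> X"
  shows "scattered G \<phi> A \<longleftrightarrow>
    (\<forall>Y. Y \<subseteq> A \<and> infinite Y \<longrightarrow>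
       (\<exists>p \<in> Remainder_of X Y. finite (Triangle G \<phi> p Y)))"
proof -
  interpret transitive_action G X \<phi> by fact
  have "(\<exists>H \<in> Fpow (carrier G). \<forall>F \<in> Fpow (carrier G).
           \<exists>y \<in> Y. Ball_in \<phi> Y y F - Ball_in \<phi> Y y H = {}) \<longleftrightarrow>
        (\<exists>p \<in> Remainder_of X Y. finite (Triangle G \<phi> p Y))" (is "?balls \<longleftrightarrow> ?ultra")
    if "Y \<subseteq> A" "infinite Y" for Y
  proof
    assume ?balls
    then show ?ultra
      using bounded_balls_imp_finite_Triangle[of Y] that \<open>A \<subseteq> X\<close> by blast
  next
    assume ?ultra
    then show ?balls
      using finite_Triangle_imp_bounded_balls[of _ Y]
      unfolding Remainder_of_def Remainder_def Beta_def by blast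
  qed
  then show ?thesis unfolding scattered_def by blast
qed

end
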